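(* Let $0<p<q$. There exists a Dirichlet polynomial $\varphi\in\mathcal G$ such that $\mathcal C_\varphi\in S_q\setminus S_p$.
   Context: For $\theta\in\mathbb R$, $\mathbb C_\theta=\{s\in\mathbb C: \mathrm{Re}\,s>\theta\}$. $\mathcal H^2$ is the Hilbert space of Dirichlet series $f(s)=\sum_{n\ge1}a_nn^{-s}$ with norm $\|f\|_{\mathcal H^2}^2=\sum_{n\ge1}|a_n|^2<\infty$; its elements are analytic in $\mathbb C_{1/2}$. The Gordon--Hedenmalm class $\mathcal G$ is the set of functions $\varphi:\mathbb C_{1/2}\to\mathbb C_{1/2}$ of the form $\varphi(s)=c_0s+\varphi_0(s)$ with $\varphi_0(s)=\sum_{n\ge1}c_nn^{-s}$, where $c_0$ is a non-negative integer, the Dirichlet series $\varphi_0$ converges uniformly in $\mathbb C_\varepsilon$ for every $\varepsilon>0$, and: (a) if $c_0=0$ then $\varphi_0(\mathbb C_0)\subset\mathbb C_{1/2}$; (b) if $c_0\ge1$ then either $\varphi_0\equiv0$ or $\varphi_0(\mathbb C_0)\subset\mathbb C_0$. A symbol in $\mathcal G$ is called a Dirichlet polynomial if it has the form $\varphi(s)=c_0s+c_1+\sum_{n=2}^Nc_nn^{-s}$. For $\varphi\in\mathcal G$, $\mathcal C_\varphi f=f\circ\varphi$ is well defined and bounded on $\mathcal H^2$. For a bounded operator $T$ on a Hilbert space, $a_n(T)$ denotes the $n$th approximation number: the distance (in operator norm) of $T$ to the operators of rank $<n$. For $0<p<\infty$, a compact operator $T$ belongs to the Schatten class $S_p$ if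 $\mathrm{Tr}(|T|^p)=\sum_{n=1}^\infty a_n(T)^p<\infty$. Here $S_p$, $S_q$ are the Schatten classes of operators on $\mathcal H^2$. *)

theory Defs
  imports "HOL-Analysis.Analysis"
begin

definition half_plane :: "real \<Rightarrow> complex set"
  where "half_plane \<theta> = {s. Re s > \<theta>}"

definition dirichlet_series :: "(nat \<Rightarrow> complex) \<Rightarrow> complex \<Rightarrow> complex"
  where "dirichlet_series a s = (\<Sum>n. a (Suc n) * of_nat (Suc n) powr (- s))"

text \<open>
  An element is represented by its coefficient sequence; the coefficient at index \<open>n \<ge> 1\<close> is the
  one of \<open>n\<close> to the power \<open>- s\<close>.  Index \<open>0\<close> is unused and pinned to \<open>0\<close>.
\<close>

typedef h2 = "{a :: nat \<Rightarrow> complex. a 0 = 0 \<and> summable (\<lambda>n. (cmod (a n))\<^sup>2)}"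
  morphisms coeff Abs_h2
  by (rule exI[of _ "\<lambda>_. 0"]) simp

setup_lifting type_definition_h2

lemma coeff_0 [simp]: "coeff f 0 = 0"
  using coeff[of f] by simp

lemma summable_coeff: "summable (\<lambda>n. (cmod (coeff f n))\<^sup>2)"
  using coeff[of f] by simp

lemma h2_eqI: "(\<And>n. coeff f n = coeff g n) \<Longrightarrow> f = g"
  by (simp add: coeff_inject[symmetric] fun_eq_iff)

lemma summable_square_add:
  fixes a b :: "nat \<Rightarrow> complex"
  assumes "summable (\<lambda>n. (cmod (a n))\<^sup>2)" "summable (\<lambda>n. (cmod (b n))\<^sup>2)"
  shows "summable (\<lambda>n. (cmod (a n + b n))\<^sup>2)"
proof (rule summable_comparison_test'[where N = 0])
  show "summable (\<lambda>n. 2 * (cmod (a n))\<^sup>2 + 2 * (cmod (b n))\<^sup>2)"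
    by (intro summable_add summable_mult assms)
  fix n
  have "(cmod (a n + b n))\<^sup>2 \<le> (cmod (a n) + cmod (b n))\<^sup>2"
    by (intro power_mono norm_triangle_ineq) auto
  also have "\<dots> \<le> 2 * (cmod (a n))\<^sup>2 + 2 * (cmod (b n))\<^sup>2"
    using zero_le_power2[of "cmod (a n) - cmod (b n)"]
    by (simp add: power2_sum power2_diff)
  finally show "norm ((cmod (a n + b n))\<^sup>2) \<le> 2 * (cmod (a n))\<^sup>2 + 2 * (cmod (b n))\<^sup>2"
    by simp
qed

lemma summable_square_scale:
  fixes a :: "nat \<Rightarrow> complex"
  assumes "summable (\<lambda>n. (cmod (a n))\<^sup>2)"
  shows "summable (\<lambda>n. (cmod (c * a n))\<^sup>2)"
  using summable_mult[OF assms, of "(cmod c)\<^sup>2"] by (simp add: norm_mult power_mult_distrib)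

lemma summable_inner_coeff: "summable (\<lambda>n. coeff f n \<bullet> coeff g n)"
proof (rule summable_comparison_test'[where N = 0])
  show "summable (\<lambda>n. (cmod (coeff f n))\<^sup>2 + (cmod (coeff g n))\<^sup>2)"
    by (intro summable_add summable_coeff)
  fix n
  have "\<bar>coeff f n \<bullet> coeff g n\<bar> \<le> cmod (coeff f n) * cmod (coeff g n)"
    by (rule Cauchy_Schwarz_ineq2)
  also have "\<dots> \<le> (cmod (coeff f n))\<^sup>2 + (cmod (coeff g n))\<^sup>2"
    using zero_le_power2[of "cmod (coeff f n) - cmod (coeff g n)"]
      zero_le_power2[of "cmod (coeff f n)"] zero_le_power2[of "cmod (coeff g n)"]
    unfolding power2_diff by linarith
  finally show "norm (coeff f n \<bullet> coeff g n) \<le> (cmod (coeff f n))\<^sup>2 + (cmod (coeff g n))\<^sup>2"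
    by simp
qed

lift_definition scaleC :: "complex \<Rightarrow> h2 \<Rightarrow> h2" (infixr \<open>*\<^sub>C\<close> 75)
  is "\<lambda>c a n. c * a n"
  by (auto intro: summable_square_scale)

lemma coeff_scaleC [simp]: "coeff (c *\<^sub>C f) n = c * coeff f n"
  by (simp add: scaleC.rep_eq)

instantiation h2 :: real_vector
begin

lift_definition zero_h2 :: h2 is "\<lambda>_. 0" by simp

lift_definition plus_h2 :: "h2 \<Rightarrow> h2 \<Rightarrow> h2" is "\<lambda>a b n. a n + b n"
  by (auto intro: summable_square_add)

lift_definition uminus_h2 :: "h2 \<Rightarrow> h2" is "\<lambda>a n. - a n" by simp

definition minus_h2 :: "h2 \<Rightarrow> h2 \<Rightarrow> h2" where "minus_h2 f g = f + - g"

definition scaleR_h2 :: "real \<Rightarrow> h2 \<Rightarrow> h2" where "scaleR_h2 r f = complex_of_real r *\<^sub>C f"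

lemma coeff_zero [simp]: "coeff 0 n = 0"
  by (simp add: zero_h2.rep_eq)

lemma coeff_add [simp]: "coeff (f + g) n = coeff f n + coeff g n"
  by (simp add: plus_h2.rep_eq)

lemma coeff_uminus [simp]: "coeff (- f) n = - coeff f n"
  by (simp add: uminus_h2.rep_eq)

lemma coeff_minus [simp]: "coeff (f - g) n = coeff f n - coeff g n"
  by (simp add: minus_h2_def)

lemma coeff_scaleR [simp]: "coeff (r *\<^sub>R f) n = r *\<^sub>R coeff f n"
  by (simp add: scaleR_h2_def scaleR_conv_of_real)

instance
  by standard (auto intro!: h2_eqI simp: algebra_simps)

end

text \<open>
  The real part of the complex inner product; it induces the norm of the Hilbert space
  (see \<open>norm_h2\<close> below), which is all that is needed here.
\<close>

instantiation h2 :: real_inner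
begin

definition inner_h2 :: "h2 \<Rightarrow> h2 \<Rightarrow> real"
  where "inner_h2 f g = (\<Sum>n. coeff f n \<bullet> coeff g n)"

definition norm_h2 :: "h2 \<Rightarrow> real" where "norm_h2 f = sqrt (f \<bullet> f)"

definition sgn_h2 :: "h2 \<Rightarrow> h2" where "sgn_h2 f = f /\<^sub>R norm f"

definition dist_h2 :: "h2 \<Rightarrow> h2 \<Rightarrow> real" where "dist_h2 f g = norm (f - g)"

definition uniformity_h2 :: "(h2 \<times> h2) filter"
  where "uniformity_h2 = (INF e\<in>{0 <..}. principal {(f, g). dist f g < e})"

definition open_h2 :: "h2 set \<Rightarrow> bool"
  where "open_h2 U \<longleftrightarrow> (\<forall>x\<in>U. eventually (\<lambda>(x', y). x' = x \<longrightarrow> y \<in> U) uniformity)"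

instance
proof
  fix f g h :: h2 and r :: real
  show "dist f g = norm (f - g)" by (rule dist_h2_def)
  show "sgn f = f /\<^sub>R norm f" by (rule sgn_h2_def)
  show "uniformity = (INF e\<in>{0 <..}. principal {(x, y). dist (x::h2) y < e})"
    by (rule uniformity_h2_def)
  show "open U \<longleftrightarrow> (\<forall>x\<in>U. eventually (\<lambda>(x', y). x' = x \<longrightarrow> y \<in> U) uniformity)" for U :: "h2 set"
    by (rule open_h2_def)
  show "f \<bullet> g = g \<bullet> f" by (simp add: inner_h2_def inner_commute)
  show "(f + g) \<bullet> h = f \<bullet> h + g \<bullet> h"
    by (simp add: inner_h2_def inner_add_left suminf_add summable_inner_coeff)
  show "(r *\<^sub>R f) \<bullet> g = r * (f \<bullet> g)"
    by (simp add: inner_h2_def suminf_mult summable_inner_coeff)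
  show "0 \<le> f \<bullet> f"
    by (simp add: inner_h2_def suminf_nonneg summable_inner_coeff)
  show "f \<bullet> f = 0 \<longleftrightarrow> f = 0"
    using suminf_eq_zero_iff[OF summable_inner_coeff[of f f]]
    by (auto simp: inner_h2_def intro: h2_eqI)
  show "norm f = sqrt (f \<bullet> f)" by (rule norm_h2_def)
qed

end

lemma norm_h2: "norm f = sqrt (\<Sum>n. (cmod (coeff f n))\<^sup>2)"
  by (simp add: norm_h2_def inner_h2_def power2_norm_eq_inner)

lemma sum_coeff_le_norm: "(\<Sum>n<N. (cmod (coeff f n))\<^sup>2) \<le> (norm f)\<^sup>2"
  by (simp add: norm_h2 suminf_nonneg summable_coeff sum_le_suminf)

lemma coeff_le_norm: "cmod (coeff f n) \<le> norm f"
proof (rule power2_le_imp_le)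
  have "(cmod (coeff f n))\<^sup>2 \<le> (\<Sum>k<Suc n. (cmod (coeff f k))\<^sup>2)"
    by (simp add: sum_nonneg)
  then show "(cmod (coeff f n))\<^sup>2 \<le> (norm f)\<^sup>2"
    using sum_coeff_le_norm[where N = "Suc n" and f = f] by linarith
qed simp

instance h2 :: banach
proof
  fix X :: "nat \<Rightarrow> h2"
  assume X: "Cauchy X"
  have "convergent (\<lambda>i. coeff (X i) n)" for n
  proof (rule Cauchy_convergent, rule CauchyI)
    fix e :: real
    assume "e > 0"
    with X obtain M where "\<And>i j. i \<ge> M \<Longrightarrow> j \<ge> M \<Longrightarrow> norm (X i - X j) < e"
      by (metis CauchyD)
    then show "\<exists>M. \<forall>i\<ge>M. \<forall>j\<ge>M. norm (coeff (X i) n - coeff (X j) n) < e"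
      using coeff_le_norm[where n = n] by (metis coeff_minus le_less_trans)
  qed
  then obtain a where a: "\<And>n. (\<lambda>i. coeff (X i) n) \<longlonglongrightarrow> a n"
    unfolding convergent_def by metis
  have a0: "a 0 = 0"
    using a[of 0] by (simp add: LIMSEQ_const_iff)
  have tail: "\<exists>M. \<forall>i\<ge>M. \<forall>N. (\<Sum>n<N. (cmod (coeff (X i) n - a n))\<^sup>2) \<le> e\<^sup>2" if "e > 0" for e
  proof -
    from X that obtain M where M: "\<And>i j. i \<ge> M \<Longrightarrow> j \<ge> M \<Longrightarrow> norm (X i - X j) < e"
      by (metis CauchyD)
    have "(\<Sum>n<N. (cmod (coeff (X i) n - a n))\<^sup>2) \<le> e\<^sup>2" if "i \<ge> M" for i N
    proof (rule LIMSEQ_le_const2)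
      show "(\<lambda>j. \<Sum>n<N. (cmod (coeff (X i) n - coeff (X j) n))\<^sup>2)
              \<longlonglongrightarrow> (\<Sum>n<N. (cmod (coeff (X i) n - a n))\<^sup>2)"
        by (intro tendsto_intros a)
      have "(\<Sum>n<N. (cmod (coeff (X i) n - coeff (X j) n))\<^sup>2) \<le> e\<^sup>2" if "j \<ge> M" for j
        using sum_coeff_le_norm[where f = "X i - X j" and N = N]
          power_mono[OF less_imp_le[OF M[OF \<open>i \<ge> M\<close> that]], of 2] by simp
      then show "\<exists>K. \<forall>j\<ge>K. (\<Sum>n<N. (cmod (coeff (X i) n - coeff (X j) n))\<^sup>2) \<le> e\<^sup>2"
        by blast
    qed
    then show ?thesis by blast
  qed
  have summable_diff: "summable (\<lambda>n. (cmod (coeff (X i) n - a n))\<^sup>2)"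
    if "\<forall>N. (\<Sum>n<N. (cmod (coeff (X i) n - a n))\<^sup>2) \<le> C" for i C
    using that by (intro bounded_imp_summable[where B = C])
      (auto simp: lessThan_Suc_atMost[symmetric] simp del: sum.lessThan_Suc)
  obtain M where "\<forall>i\<ge>M. \<forall>N. (\<Sum>n<N. (cmod (coeff (X i) n - a n))\<^sup>2) \<le> 1\<^sup>2"
    using tail[of 1] by auto
  then have "summable (\<lambda>n. (cmod (coeff (X M) n - a n))\<^sup>2)"
    by (intro summable_diff) auto
  then have "summable (\<lambda>n. (cmod (a n - coeff (X M) n))\<^sup>2)"
    by (simp add: norm_minus_commute)
  from summable_square_add[OF this summable_coeff[of "X M"]]
  have "summable (\<lambda>n. (cmod (a n))\<^sup>2)" by simp
  then have coeff_L: "coeff (Abs_h2 a) = a"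
    using a0 by (simp add: Abs_h2_inverse)
  have "X \<longlonglongrightarrow> Abs_h2 a"
  proof (rule LIMSEQ_I)
    fix e :: real
    assume "e > 0"
    then obtain M where M: "\<forall>i\<ge>M. \<forall>N. (\<Sum>n<N. (cmod (coeff (X i) n - a n))\<^sup>2) \<le> (e/2)\<^sup>2"
      using tail[of "e/2"] by auto
    have "norm (X i - Abs_h2 a) < e" if "i \<ge> M" for i
    proof -
      have "(\<Sum>n. (cmod (coeff (X i) n - a n))\<^sup>2) \<le> (e/2)\<^sup>2"
        using M that by (intro suminf_le_const summable_diff) auto
      then have "norm (X i - Abs_h2 a) \<le> sqrt ((e/2)\<^sup>2)"
        unfolding norm_h2 coeff_minus coeff_L by (rule real_sqrt_le_mono)
      then show ?thesis using \<open>e > 0\<close> by simp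
    qed
    then show "\<exists>M. \<forall>i\<ge>M. norm (X i - Abs_h2 a) < e" by blast
  qed
  then show "convergent X" by (rule convergentI)
qed

global_interpretation h2: vector_space scaleC
  by unfold_locales (auto intro!: h2_eqI simp: algebra_simps)

definition h2_eval :: "h2 \<Rightarrow> complex \<Rightarrow> complex"
  where "h2_eval f = dirichlet_series (coeff f)"

text \<open>
  Symbols are total functions of which only the values on \<open>half_plane (1/2)\<close> matter.
\<close>

definition gordon_hedenmalm :: "(complex \<Rightarrow> complex) set"
  where "gordon_hedenmalm = {\<phi>. \<phi> ` half_plane (1/2) \<subseteq> half_plane (1/2) \<and>
    (\<exists>(c\<^sub>0::nat) (c::nat \<Rightarrow> complex).
       (\<forall>s\<in>half_plane (1/2). \<phi> s = of_nat c\<^sub>0 * s + dirichlet_series c s) \<and>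
       (\<forall>\<epsilon>>0. uniform_limit (half_plane \<epsilon>)
          (\<lambda>N s. \<Sum>n=1..N. c n * of_nat n powr (- s)) (dirichlet_series c) sequentially) \<and>
       (c\<^sub>0 = 0 \<longrightarrow> dirichlet_series c ` half_plane 0 \<subseteq> half_plane (1/2)) \<and>
       (c\<^sub>0 \<ge> 1 \<longrightarrow> (\<forall>s\<in>half_plane 0. dirichlet_series c s = 0) \<or>
                   dirichlet_series c ` half_plane 0 \<subseteq> half_plane 0))}"

definition dirichlet_polynomial :: "(complex \<Rightarrow> complex) \<Rightarrow> bool"
  where "dirichlet_polynomial \<phi> \<longleftrightarrow>
    (\<exists>(c\<^sub>0::nat) (c::nat \<Rightarrow> complex) (N::nat). \<forall>s\<in>half_plane (1/2).
       \<phi> s = of_nat c\<^sub>0 * s + c 1 + (\<Sum>n=2..N. c n * of_nat n powr (- s)))"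

text \<open>
  The Dirichlet series of \<open>f \<circ> \<phi>\<close>, determined by its values on \<open>half_plane (1/2)\<close>.  It exists for
  every \<open>f\<close> if \<open>\<phi> \<in> gordon_hedenmalm\<close>, and coefficients of a Dirichlet series are unique.
\<close>

definition composition_operator :: "(complex \<Rightarrow> complex) \<Rightarrow> h2 \<Rightarrow> h2"
  where "composition_operator \<phi> f =
    (THE g. \<forall>s\<in>half_plane (1/2). h2_eval g s = h2_eval f (\<phi> s))"

definition bounded_operator :: "(h2 \<Rightarrow> h2) \<Rightarrow> bool"
  where "bounded_operator T \<longleftrightarrow> bounded_linear T \<and> (\<forall>c f. T (c *\<^sub>C f) = c *\<^sub>C T f)"

text \<open>
  The rank is phrased via spanning sets since \<open>h2.dim\<close> is \<open>0\<close> on infinite-dimensional subspaces.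
\<close>

definition rank_less :: "nat \<Rightarrow> (h2 \<Rightarrow> h2) \<Rightarrow> bool"
  where "rank_less n T \<longleftrightarrow> (\<exists>B. finite B \<and> card B < n \<and> range T \<subseteq> h2.span B)"

text \<open>Meaningful for \<open>n \<ge> 1\<close> only: no operator has rank less than \<open>0\<close>.\<close>

definition approximation_number :: "nat \<Rightarrow> (h2 \<Rightarrow> h2) \<Rightarrow> real"
  where "approximation_number n T =
    (INF R\<in>{R. bounded_operator R \<and> rank_less n R}. onorm (\<lambda>f. T f - R f))"

definition compact_operator :: "(h2 \<Rightarrow> h2) \<Rightarrow> bool"
  where "compact_operator T \<longleftrightarrow> bounded_operator T \<and> compact (closure (T ` cball 0 1))"

definition schatten_class :: "real \<Rightarrow> (h2 \<Rightarrow> h2) set"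
  where "schatten_class p =
    {T. compact_operator T \<and> summable (\<lambda>n. approximation_number (Suc n) T powr p)}"

end

theory Submission
  imports Defs
begin

text \<open>
  The vertical translation \<open>s \<mapsto> s + 1 / p\<close> is a Dirichlet polynomial with \<open>c\<^sub>0 = 1\<close>.  Composition with
  it multiplies the \<open>n\<close>-th coefficient by \<open>n powr (- 1 / p)\<close>, so the operator is diagonal and its
  \<open>n\<close>-th approximation number is the \<open>n\<close>-th weight.  Hence it belongs to the Schatten class of
  exponent \<open>r\<close> if and only if the sum of \<open>n powr (- r / p)\<close> converges, that is, if and only if \<open>r > p\<close>.
\<close>

section \<open>Norm estimates through coefficients\<close>

lemma norm_h2_le:
  assumes "C \<ge> 0" and "\<And>n. cmod (coeff f n) \<le> C * cmod (coeff g n)"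
  shows "norm f \<le> C * norm g"
proof -
  have le: "(cmod (coeff f n))\<^sup>2 \<le> C\<^sup>2 * (cmod (coeff g n))\<^sup>2" for n
    using power_mono[OF assms(2) norm_ge_zero, of n 2] by (simp add: power_mult_distrib)
  have "(norm f)\<^sup>2 = (\<Sum>n. (cmod (coeff f n))\<^sup>2)"
    by (simp add: norm_h2 suminf_nonneg summable_coeff)
  also have "\<dots> \<le> (\<Sum>n. C\<^sup>2 * (cmod (coeff g n))\<^sup>2)"
    by (intro suminf_le le summable_mult summable_coeff)
  also have "\<dots> = (C * norm g)\<^sup>2"
    by (simp add: norm_h2 suminf_nonneg summable_coeff suminf_mult power_mult_distrib)
  finally show ?thesis
    by (rule power2_le_imp_le) (use assms(1) in simp)
qed

lemma coeff_sum [simp]: "coeff (sum f A) n = (\<Sum>x\<in>A. coeff (f x) n)"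
  using sum_comp_morphism[of "\<lambda>f. coeff f n" f A] by (simp add: comp_def)

section \<open>Uniqueness of Dirichlet coefficients\<close>

lemma summable_coeff_div_square:
  "summable (\<lambda>n. cmod (coeff f (Suc n) / of_nat (Suc n) ^ 2))"
proof (rule summable_comparison_test'[where N = 0])
  show "summable (\<lambda>n. norm f * inverse (real (Suc n) ^ 2))"
    using inverse_power_summable[of 2, where 'a = real]
      summable_Suc_iff[of "\<lambda>n. inverse (real n ^ 2)"]
    by (intro summable_mult) simp
  have "cmod (coeff f (Suc n)) * inverse (real (Suc n) ^ 2) \<le> norm f * inverse (real (Suc n) ^ 2)" for n
    by (intro mult_right_mono coeff_le_norm) simp
  then show "norm (cmod (coeff f (Suc n) / of_nat (Suc n) ^ 2)) \<le> norm f * inverse (real (Suc n) ^ 2)" for n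
    unfolding real_norm_def abs_norm_cancel norm_divide norm_power norm_of_nat divide_inverse
    by (simp only: norm_divide norm_mult norm_inverse norm_power norm_of_nat abs_norm_cancel)
qed

text \<open>Splitting the exponent as \<open>2 + k\<close> separates an absolutely summable factor
  that does not depend on \<open>k\<close> from the powers of \<open>1 / Suc n\<close>, which are at
  most 1. This is the form that dominated convergence in \<open>k\<close> needs.\<close>

lemma h2_eval_of_nat:
  "h2_eval f (of_nat (k + 2)) =
     (\<Sum>n. coeff f (Suc n) / of_nat (Suc n) ^ 2 * inverse (of_nat (Suc n)) ^ k)"
proof -
  have "of_nat (Suc n) powr (- of_nat (k + 2)) = inverse (of_nat (Suc n) ^ (k + 2) :: complex)" for n
    by (subst powr_minus, subst powr_nat') (simp_all del: of_nat_Suc of_nat_add)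
  then show ?thesis
    by (simp only: h2_eval_def dirichlet_series_def power_add divide_inverse power_inverse
        inverse_mult_distrib mult_ac)
qed

text \<open>Along the integers \<open>k + 2\<close> the first nonvanishing term of a Dirichlet
  series dominates all later ones, so a difference with zero values there has no first nonvanishing
  term. This supplies the uniqueness behind \<open>THE\<close> in
  \<open>composition_operator\<close>.\<close>

lemma h2_eval_inject:
  assumes eq: "\<And>k. h2_eval f (of_nat (k + 2)) = h2_eval g (of_nat (k + 2))"
  shows "f = g"
proof -
  define b where "b n = coeff (f - g) (Suc n) / of_nat (Suc n) ^ 2" for n
  have sb: "summable (\<lambda>n. norm (b n))"
    unfolding b_def by (rule summable_coeff_div_square)
  have sm: "summable (\<lambda>n. coeff h (Suc n) / of_nat (Suc n) ^ 2 * inverse (of_nat (Suc n)) ^ k)" for h k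
  proof (rule summable_comparison_test'[where N = 0])
    show "summable (\<lambda>n. norm (coeff h (Suc n) / of_nat (Suc n) ^ 2))"
      by (rule summable_coeff_div_square)
    have "inverse (real (Suc n)) ^ k \<le> 1" for n
      by (intro power_le_one) (auto simp: field_simps)
    then show "norm (coeff h (Suc n) / of_nat (Suc n) ^ 2 * inverse (of_nat (Suc n)) ^ k)
        \<le> norm (coeff h (Suc n) / of_nat (Suc n) ^ 2)" for n
      unfolding norm_mult norm_power norm_inverse norm_of_nat
      by (rule mult_left_le) simp
  qed
  have sum0: "(\<Sum>n. b n * inverse (of_nat (Suc n)) ^ k) = 0" for k
  proof -
    have "(\<Sum>n. b n * inverse (of_nat (Suc n)) ^ k) =
        h2_eval f (of_nat (k + 2)) - h2_eval g (of_nat (k + 2))"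
      unfolding h2_eval_of_nat suminf_diff[OF sm[of f k] sm[of g k]] b_def coeff_minus
        diff_divide_distrib left_diff_distrib ..
    then show ?thesis using eq[of k] by simp
  qed
  have smb: "summable (\<lambda>n. b n * inverse (of_nat (Suc n)) ^ k)" for k
    unfolding b_def by (rule sm)
  have b0: "b m = 0" for m
  proof (induction m rule: less_induct)
    case (less m)
    \<comment> \<open>Rescaled by \<open>Suc m ^ k\<close>, the later terms vanish as \<open>k\<close> grows, which isolates \<open>b m\<close>.\<close>
    define t where "t k n = b n * (of_nat (Suc m) / of_nat (Suc n)) ^ k" for k n
    have t0: "(\<Sum>n. t k n) = 0" for k
    proof -
      have "t k = (\<lambda>n. of_nat (Suc m) ^ k * (b n * inverse (of_nat (Suc n)) ^ k))"
        by (rule ext) (simp only: t_def divide_inverse power_mult_distrib mult_ac)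
      then show ?thesis
        by (simp only: suminf_mult[OF smb] sum0 mult_zero_right)
    qed
    have "(\<forall>\<^sub>F k in sequentially. summable (\<lambda>n. norm (t k n))) \<and>
        summable (\<lambda>n. norm (if n = m then b m else 0)) \<and>
        (\<lambda>k. \<Sum>n. t k n) \<longlonglongrightarrow> (\<Sum>n. if n = m then b m else 0)"
    proof (rule tannerys_theorem)
      show "summable (\<lambda>n. norm (b n))" by (rule sb)
      show "\<forall>\<^sub>F (n, k) in sequentially \<times>\<^sub>F sequentially. norm (t k n) \<le> norm (b n)"
      proof (rule always_eventually, safe)
        fix n k
        show "norm (t k n) \<le> norm (b n)"
        \<comment> \<open>For \<open>n < m\<close> the ratio exceeds 1, and only the induction
          hypothesis \<open>b n = 0\<close> keeps the term dominated; for \<open>n \<ge> m\<close>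
          the ratio is at most 1.\<close>
        proof (cases "n < m")
          case True
          then show ?thesis by (simp add: t_def less)
        next
          case False
          then have "(real (Suc m) / real (Suc n)) ^ k \<le> 1"
            by (intro power_le_one) auto
          then show ?thesis
            unfolding t_def norm_mult norm_power norm_divide norm_of_nat
            by (rule mult_left_le) simp
        qed
      qed
      show "(\<lambda>k. t k n) \<longlonglongrightarrow> (if n = m then b m else 0)" for n
      proof (cases n m rule: linorder_cases)
        case greater
        then have "norm (of_nat (Suc m) / of_nat (Suc n) :: complex) < 1"
          by (simp add: norm_divide del: of_nat_Suc)
        from tendsto_mult_right_zero[OF LIMSEQ_power_zero[OF this], of "b n"] show ?thesis
          using greater by (simp add: t_def del: of_nat_Suc)
      qed (simp_all add: t_def less del: of_nat_Suc)
    qed simp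
    moreover have "(\<Sum>n. if n = m then b m else 0) = b m"
      using sums_If_finite_set[of "{m}" "\<lambda>_. b m"] by (simp add: sums_iff)
    ultimately show ?case
      by (simp add: t0 LIMSEQ_const_iff)
  qed
  show "f = g"
  proof (rule h2_eqI)
    show "coeff f n = coeff g n" for n
      using b0[of "n - 1"] by (cases n) (auto simp: b_def simp del: of_nat_Suc)
  qed
qed

section \<open>Diagonal operators\<close>

text \<open>\<open>Abs_h2\<close> is meaningful only on square summable sequences; the facts below
  secure this by a bound on the weights.\<close>

definition multiplier :: "(nat \<Rightarrow> real) \<Rightarrow> h2 \<Rightarrow> h2"
  where "multiplier w f = Abs_h2 (\<lambda>n. of_real (w n) * coeff f n)"

lemma coeff_multiplier:
  assumes "\<And>n. \<bar>w n\<bar> \<le> C"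
  shows "coeff (multiplier w f) n = of_real (w n) * coeff f n"
proof -
  have "summable (\<lambda>n. (cmod (of_real (w n) * coeff f n))\<^sup>2)"
  proof (rule summable_comparison_test'[where N = 0])
    show "summable (\<lambda>n. C\<^sup>2 * (cmod (coeff f n))\<^sup>2)"
      by (intro summable_mult summable_coeff)
    show "norm ((cmod (of_real (w n) * coeff f n))\<^sup>2) \<le> C\<^sup>2 * (cmod (coeff f n))\<^sup>2" for n
      using power_mono[OF assms[of n], of 2]
      by (simp add: norm_mult power_mult_distrib mult_right_mono)
  qed
  then show ?thesis
    by (simp add: multiplier_def Abs_h2_inverse)
qed

lemma norm_multiplier_le:
  assumes "\<And>n. \<bar>w n\<bar> \<le> C"
  shows "norm (multiplier w f) \<le> C * norm f"
proof (rule norm_h2_le)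
  show "C \<ge> 0" using assms[of 0] by linarith
  show "cmod (coeff (multiplier w f) n) \<le> C * cmod (coeff f n)" for n
    using assms by (simp add: coeff_multiplier[OF assms] norm_mult mult_right_mono)
qed

lemma bounded_operator_multiplier:
  assumes "\<And>n. \<bar>w n\<bar> \<le> C"
  shows "bounded_operator (multiplier w)"
  unfolding bounded_operator_def
proof (intro conjI allI)
  show "bounded_linear (multiplier w)"
  proof (rule bounded_linear_intro[where K = C])
    show "norm (multiplier w f) \<le> norm f * C" for f
      using norm_multiplier_le[OF assms, where f = f] by (simp add: mult.commute)
  qed (auto intro!: h2_eqI simp: coeff_multiplier[OF assms] algebra_simps scaleR_conv_of_real)
  show "multiplier w (c *\<^sub>C f) = c *\<^sub>C multiplier w f" for c f
    by (auto intro!: h2_eqI simp: coeff_multiplier[OF assms])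
qed

section \<open>The orthonormal basis of monomials\<close>

text \<open>The clause \<open>k \<noteq> 0\<close> respects the pinned coefficient at index 0:
  \<open>monomial 0\<close> is the zero vector.\<close>

definition monomial :: "nat \<Rightarrow> h2"
  where "monomial k = Abs_h2 (\<lambda>n. if n = k \<and> k \<noteq> 0 then 1 else 0)"

lemma coeff_monomial: "coeff (monomial k) n = (if n = k \<and> k \<noteq> 0 then 1 else 0)"
proof -
  have "summable (\<lambda>n. (cmod (if n = k \<and> k \<noteq> 0 then 1 else 0))\<^sup>2)"
    by (rule summable_finite[of "{k}"]) auto
  then show ?thesis
    unfolding monomial_def by (subst Abs_h2_inverse) auto
qed

lemma h2_finite_expansion:
  assumes "\<And>k. k \<ge> n \<Longrightarrow> coeff f k = 0"
  shows "f = (\<Sum>k\<in>{1..<n}. coeff f k *\<^sub>C monomial k)"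
proof (rule h2_eqI)
  fix m
  have "(\<Sum>k\<in>{1..<n}. coeff f k * (if m = k \<and> k \<noteq> 0 then 1 else 0)) =
      (\<Sum>k\<in>{1..<n}. if k = m then coeff f m else 0)"
    by (intro sum.cong) auto
  also have "\<dots> = coeff f m"
    using assms[of m] by (cases "m = 0") (auto simp: sum.delta)
  finally show "coeff f m = coeff (\<Sum>k\<in>{1..<n}. coeff f k *\<^sub>C monomial k) m"
    by (simp add: coeff_monomial)
qed

lemma inj_on_monomial: "inj_on monomial {1..n}"
  by (rule inj_onI) (metis coeff_monomial atLeastAtMost_iff not_one_le_zero zero_neq_one)

lemma independent_monomial: "h2.independent (monomial ` {1..n})"
proof (rule h2.independent_if_scalars_zero)
  fix u x
  assume 0: "(\<Sum>x\<in>monomial ` {1..n}. u x *\<^sub>C x) = 0" and "x \<in> monomial ` {1..n}"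
  then obtain k where k: "k \<in> {1..n}" "x = monomial k" by auto
  have "0 = coeff (\<Sum>j\<in>{1..n}. u (monomial j) *\<^sub>C monomial j) k"
    using arg_cong[OF 0, of "\<lambda>f. coeff f k"] unfolding sum.reindex[OF inj_on_monomial] o_def by simp
  also have "\<dots> = (\<Sum>j\<in>{1..n}. if j = k then u x else 0)"
    unfolding coeff_sum using k by (intro sum.cong) (auto simp: coeff_monomial)
  also have "\<dots> = u x"
    using k by simp
  finally show "u x = 0" by simp
qed simp

lemma card_monomial: "card (monomial ` {1..n}) = n"
  by (simp only: card_image inj_on_monomial card_atLeastAtMost)

section \<open>Compactness of diagonal operators\<close>

text \<open>Heine-Borel for Dirichlet polynomials, one coefficient at a time: admitting a further
  coefficient turns the set into the continuous image of its product with a closed disc.\<close>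

lemma compact_polynomial_ball:
  "compact {f. (\<forall>k\<ge>n. coeff f k = 0) \<and> (\<forall>k. cmod (coeff f k) \<le> C)}" (is "compact (?K n)")
proof (induction n)
  case 0
  show ?case
  proof (rule finite_imp_compact, rule finite_subset)
    show "?K 0 \<subseteq> {0}" by (auto intro: h2_eqI)
  qed simp
next
  case (Suc n)
  have lin: "bounded_linear (\<lambda>c. c *\<^sub>C monomial n)"
  proof (rule bounded_linear_intro[where K = "norm (monomial n)"])
    show "norm (c *\<^sub>C monomial n) \<le> norm c * norm (monomial n)" for c
      by (rule norm_h2_le) (simp_all add: norm_mult)
  qed (auto intro!: h2_eqI simp: algebra_simps scaleR_conv_of_real)
  define h where "h = (\<lambda>(f, c). f + c *\<^sub>C monomial n)"
  have compact_h: "compact (h ` (?K n \<times> cball 0 C))"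
    unfolding h_def case_prod_unfold
    by (intro compact_continuous_image compact_Times Suc compact_cball continuous_intros
        bounded_linear.continuous_on[OF lin])
  have "?K (Suc n) \<subseteq> h ` (?K n \<times> cball 0 C)"
  proof
    fix f assume f: "f \<in> ?K (Suc n)"
    define g where "g = f - coeff f n *\<^sub>C monomial n"
    have "f = h (g, coeff f n)"
      by (simp add: h_def g_def)
    moreover have "g \<in> ?K n"
    proof (safe)
      show "coeff g k = 0" if "k \<ge> n" for k
        using f that by (cases "k = n") (auto simp: g_def coeff_monomial)
      \<comment> \<open>The existence of \<open>f\<close> forces the sign of \<open>C\<close>, which
        then bounds the deleted coefficient 0 of \<open>g\<close>.\<close>
      have "C \<ge> 0" using f norm_ge_zero order_trans by blast
      then show "cmod (coeff g k) \<le> C" for k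
        using f by (cases "k = n") (auto simp: g_def coeff_monomial)
    qed
    ultimately show "f \<in> h ` (?K n \<times> cball 0 C)"
      using f by (intro image_eqI[of _ _ "(g, coeff f n)"]) auto
  qed
  moreover have "h ` (?K n \<times> cball 0 C) \<subseteq> ?K (Suc n)"
    by (auto simp: h_def coeff_monomial)
  ultimately have "?K (Suc n) = h ` (?K n \<times> cball 0 C)"
    by (rule subset_antisym)
  then show ?case
    using compact_h by (simp only:)
qed

text \<open>Since the weights tend to 0, the operator is a norm limit of truncations, each of which
  maps the unit ball into a compact set. The image of the unit ball is therefore totally bounded,
  and its closure is compact by completeness.\<close>

lemma compact_operator_multiplier:
  assumes bdd: "\<And>n. \<bar>w n\<bar> \<le> C" and lim: "w \<longlonglongrightarrow> 0"
  shows "compact_operator (multiplier w)"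
  unfolding compact_operator_def
proof
  show "bounded_operator (multiplier w)"
    by (rule bounded_operator_multiplier) (rule bdd)
  have C: "C \<ge> 0" using bdd[of 0] by linarith
  let ?S = "multiplier w ` cball 0 1"
  have tb: "\<exists>k. finite k \<and> ?S \<subseteq> (\<Union>x\<in>k. ball x e)" if "e > 0" for e
  proof -
    obtain N where "\<forall>n\<ge>N. norm (w n - 0) < e / 2"
      using LIMSEQ_D[OF lim half_gt_zero[OF \<open>e > 0\<close>]] by blast
    then have N: "\<And>n. n \<ge> N \<Longrightarrow> \<bar>w n\<bar> < e / 2" by simp
    let ?K = "{f. (\<forall>k\<ge>N. coeff f k = 0) \<and> (\<forall>k. cmod (coeff f k) \<le> C)}"
    have "compact ?K" by (rule compact_polynomial_ball)
    then obtain k where k: "finite k" "?K \<subseteq> (\<Union>x\<in>k. ball x (e / 2))"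
      using half_gt_zero[OF \<open>e > 0\<close>] unfolding compact_eq_totally_bounded by blast
    \<comment> \<open>Cutting the weights at \<open>N\<close> moves the image of each unit vector by
      at most \<open>e / 2\<close>, so an \<open>e / 2\<close>-net of \<open>?K\<close> is an
      \<open>e\<close>-net of \<open>?S\<close>.\<close>
    define v where "v n = (if n < N then w n else 0)" for n
    have v: "\<bar>v n\<bar> \<le> C" for n using bdd C by (simp add: v_def)
    have "multiplier w f \<in> (\<Union>x\<in>k. ball x e)" if f: "norm f \<le> 1" for f
    proof -
      have "cmod (of_real (v n) * coeff f n) \<le> C" for n
        using mult_mono[OF v order_trans[OF coeff_le_norm f] C norm_ge_zero, of n n]
        by (simp add: norm_mult)
      then have "multiplier v f \<in> ?K"
        by (simp add: coeff_multiplier[OF v]) (simp add: v_def)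
      then obtain x where x: "x \<in> k" "dist x (multiplier v f) < e / 2"
        using k by auto
      have "norm (multiplier v f - multiplier w f) \<le> e / 2 * norm f"
      proof (rule norm_h2_le)
        have "\<bar>v n - w n\<bar> \<le> e / 2" for n
          using N[of n] \<open>e > 0\<close> by (auto simp: v_def)
        moreover have "cmod (coeff (multiplier v f - multiplier w f) n) = \<bar>v n - w n\<bar> * cmod (coeff f n)" for n
          by (simp add: coeff_multiplier[OF v] coeff_multiplier[OF bdd] norm_mult
              flip: left_diff_distrib of_real_diff)
        ultimately show "cmod (coeff (multiplier v f - multiplier w f) n) \<le> e / 2 * cmod (coeff f n)" for n
          by (simp only: mult_right_mono norm_ge_zero)
      qed (use \<open>e > 0\<close> in simp)
      also have "\<dots> \<le> e / 2"
        using f \<open>e > 0\<close> by (simp add: mult_left_le)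
      finally have "dist x (multiplier w f) < e"
        using x dist_triangle[of x "multiplier w f" "multiplier v f"] by (simp add: dist_norm)
      with x show ?thesis by auto
    qed
    with k show ?thesis by (intro exI[of _ k]) auto
  qed
  \<comment> \<open>Halving the radius passes to the closure: finitely many closed balls of radius
    \<open>e / 2\<close> have a closed union, and each lies in the open ball of radius
    \<open>e\<close>.\<close>
  have "\<exists>k. finite k \<and> closure ?S \<subseteq> (\<Union>x\<in>k. ball x e)" if "e > 0" for e
  proof -
    obtain k where k: "finite k" "?S \<subseteq> (\<Union>x\<in>k. ball x (e / 2))"
      using tb[OF half_gt_zero[OF \<open>e > 0\<close>]] by blast
    have "closure ?S \<subseteq> (\<Union>x\<in>k. cball x (e / 2))"
    proof (rule closure_minimal)
      show "?S \<subseteq> (\<Union>x\<in>k. cball x (e / 2))"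
        using k(2) ball_subset_cball by blast
    qed (intro closed_UN k closed_cball ballI)
    also have "\<dots> \<subseteq> (\<Union>x\<in>k. ball x e)"
      using \<open>e > 0\<close> by (intro UN_mono subset_refl) auto
    finally show ?thesis using k by blast
  qed
  then show "compact (closure ?S)"
    unfolding compact_eq_totally_bounded complete_eq_closed by (intro conjI closed_closure) blast
qed

section \<open>Approximation numbers of diagonal operators\<close>

text \<open>Index 0 carries no coefficient, so only the \<open>n - 1\<close> monomials with index
  from 1 to \<open>n - 1\<close> survive.\<close>

lemma rank_less_multiplier:
  assumes bdd: "\<And>k. \<bar>w k\<bar> \<le> C" and "\<And>k. k \<ge> n \<Longrightarrow> w k = 0" and "n \<ge> 1"
  shows "rank_less n (multiplier w)"
  unfolding rank_less_def
proof (intro exI conjI subsetI)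
  show "card (monomial ` {1..<n}) < n"
    using card_image_le[of "{1..<n}" monomial] \<open>n \<ge> 1\<close> by simp
  fix g assume "g \<in> range (multiplier w)"
  then have "coeff g k = 0" if "k \<ge> n" for k
    using that assms(2) by (auto simp: coeff_multiplier[OF bdd])
  then have "g = (\<Sum>k\<in>{1..<n}. coeff g k *\<^sub>C monomial k)"
    by (rule h2_finite_expansion)
  also have "\<dots> \<in> h2.span (monomial ` {1..<n})"
    by (intro h2.span_sum h2.span_scale h2.span_base imageI)
  finally show "g \<in> h2.span (monomial ` {1..<n})" .
qed simp

text \<open>A dimension count: the first \<open>n\<close> monomials span a space of dimension
  \<open>n\<close>, which a map into the span of fewer than \<open>n\<close> vectors cannot
  embed.\<close>

lemma rank_less_kernel:
  assumes "bounded_operator R" "rank_less n R"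
  obtains f where "f \<noteq> 0" "R f = 0" "\<And>k. k > n \<Longrightarrow> coeff f k = 0"
proof -
  let ?E = "monomial ` {1..n}"
  obtain B where B: "finite B" "card B < n" "range R \<subseteq> h2.span B"
    using assms(2) unfolding rank_less_def by blast
  have "R (f + g) = R f + R g" "R (c *\<^sub>C f) = c *\<^sub>C R f" for f g c
    using assms(1) by (auto simp: bounded_operator_def intro: linear_add bounded_linear.linear)
  then interpret R: Vector_Spaces.linear scaleC scaleC R
    by unfold_locales
  have "\<not> inj_on R (h2.span ?E)"
  proof
    assume inj: "inj_on R (h2.span ?E)"
    then have "h2.independent (R ` ?E)"
      using R.independent_injective_image independent_monomial by blast
    then have "card (R ` ?E) \<le> card B"
      using h2.independent_span_bound[of B "R ` ?E"] B by blast
    moreover have "card (R ` ?E) = n"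
      using card_image[OF inj_on_subset[OF inj h2.span_superset]] card_monomial[of n] by simp
    ultimately show False using B by simp
  qed
  then obtain f where f: "f \<in> h2.span ?E" "f \<noteq> 0" "R f = 0"
    using R.inj_on_iff_eq_0[OF h2.subspace_span] by blast
  have "h2.span ?E \<subseteq> {f. \<forall>k>n. coeff f k = 0}"
    by (rule h2.span_minimal) (auto simp: coeff_monomial h2.subspace_def)
  with f that show thesis by blast
qed

text \<open>The upper bound comes from truncating the weights, the lower bound from testing on a
  kernel vector of the competitor. Monotonicity starts at index 1 because the intended weights
  \<open>real n powr - \<alpha>\<close> vanish at 0; together with \<open>w 0 = 0\<close> it makes
  \<open>w 1\<close> a bound for all weights.\<close>

lemma approximation_number_multiplier:
  assumes nonneg: "\<And>k. w k \<ge> 0" and "w 0 = 0"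
    and decr: "\<And>j k. 1 \<le> j \<Longrightarrow> j \<le> k \<Longrightarrow> w k \<le> w j" and "n \<ge> 1"
  shows "approximation_number n (multiplier w) = w n"
proof -
  have bdd: "\<bar>w k\<bar> \<le> w 1" for k
    using nonneg[of k] nonneg[of 1] decr[of 1 k] \<open>w 0 = 0\<close> by (cases "k = 0") auto
  let ?A = "{R. bounded_operator R \<and> rank_less n R}"
  \<comment> \<open>The near-optimal competitor: it keeps the weights below \<open>n\<close>, and by
    monotonicity each dropped weight is at most \<open>w n\<close>.\<close>
  define v where "v k = (if k < n then w k else 0)" for k
  have v: "\<bar>v k\<bar> \<le> w 1" for k
    using bdd nonneg by (simp add: v_def)
  have vA: "multiplier v \<in> ?A"
    using bounded_operator_multiplier[of v, OF v] rank_less_multiplier[of v, OF v _ \<open>n \<ge> 1\<close>]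
    by (simp add: v_def)
  have bl: "bounded_linear (\<lambda>f. multiplier w f - R f)" if "R \<in> ?A" for R
    using that bounded_operator_multiplier[of w, OF bdd]
    by (intro bounded_linear_sub) (auto simp: bounded_operator_def)
  show ?thesis
  proof (rule antisym)
    have "approximation_number n (multiplier w) \<le> onorm (\<lambda>f. multiplier w f - multiplier v f)"
      unfolding approximation_number_def
      by (intro cINF_lower[OF _ vA] bdd_belowI2[where m = 0] onorm_pos_le bl)
    also have "\<dots> \<le> w n"
    proof (rule onorm_bound)
      have "\<bar>w k - v k\<bar> \<le> w n" for k
        using nonneg decr[OF \<open>n \<ge> 1\<close>, of k] by (simp add: v_def)
      then show "norm (multiplier w f - multiplier v f) \<le> w n * norm f" for f
        by (intro norm_h2_le nonneg)
          (simp add: coeff_multiplier[OF v] coeff_multiplier[OF bdd] mult_right_mono norm_mult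
              flip: left_diff_distrib of_real_diff)
    qed (rule nonneg)
    finally show "approximation_number n (multiplier w) \<le> w n" .
    show "w n \<le> approximation_number n (multiplier w)"
      unfolding approximation_number_def
    proof (rule cINF_greatest)
      show "?A \<noteq> {}" using vA by blast
      fix R assume R: "R \<in> ?A"
      then obtain f where f: "f \<noteq> 0" "R f = 0" "\<And>k. k > n \<Longrightarrow> coeff f k = 0"
        using rank_less_kernel by blast
      \<comment> \<open>All nonzero coefficients of \<open>f\<close> have index between 1 and
        \<open>n\<close>, where the weights are at least \<open>w n\<close>. As
        \<open>R f = 0\<close>, the difference of the operators stretches \<open>f\<close> by at
        least \<open>w n\<close>.\<close>
      have "norm (w n *\<^sub>R f) \<le> 1 * norm (multiplier w f)"
      proof (rule norm_h2_le)
        show "cmod (coeff (w n *\<^sub>R f) k) \<le> 1 * cmod (coeff (multiplier w f) k)" for k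
          using f(3)[of k] decr[of k n] nonneg
          by (cases "k = 0 \<or> k > n")
            (auto simp: coeff_multiplier[OF bdd] norm_mult mult_right_mono)
      qed simp
      also have "1 * norm (multiplier w f) = norm (multiplier w f - R f)"
        using f by simp
      also have "\<dots> \<le> onorm (\<lambda>f. multiplier w f - R f) * norm f"
        by (rule onorm[OF bl[OF R]])
      finally show "w n \<le> onorm (\<lambda>f. multiplier w f - R f)"
        using f(1) nonneg by simp
    qed
  qed
qed

section \<open>Translations as symbols\<close>

context
  fixes \<alpha> :: real
  assumes \<alpha>: "\<alpha> > 0"
begin

lemma translation_weight_le_1: "\<bar>real n powr - \<alpha>\<bar> \<le> 1"
  \<comment> \<open>At \<open>n = 0\<close> the power is 0 by convention.\<close>
  using \<alpha> by (cases "n = 0") (auto simp: powr_minus inverse_le_1_iff ge_one_powr_ge_zero)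

text \<open>The factor \<open>n powr - \<alpha>\<close> moves from the power into the coefficient.
  The two series agree term by term, so no convergence is involved and \<open>s\<close> is
  arbitrary.\<close>

lemma h2_eval_translation:
  "h2_eval (multiplier (\<lambda>n. real n powr - \<alpha>) f) s = h2_eval f (s + of_real \<alpha>)"
proof -
  have "of_nat (Suc n) powr (- (s + of_real \<alpha>)) =
      of_nat (Suc n) powr (- s) * complex_of_real (real (Suc n) powr - \<alpha>)" for n
    using powr_of_real[of "real (Suc n)" "- \<alpha>"]
    by (simp add: powr_diff powr_minus divide_inverse del: of_nat_Suc)
  then show ?thesis
    by (simp add: h2_eval_def dirichlet_series_def coeff_multiplier[OF translation_weight_le_1]
        mult_ac del: of_nat_Suc)
qed

text \<open>The previous identity shows that the diagonal operator satisfies the defining equation;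
  \<open>h2_eval_inject\<close> makes it the only solution, since the integers \<open>k + 2\<close>
  lie in the half-plane.\<close>

lemma composition_operator_translation:
  "composition_operator (\<lambda>s. s + of_real \<alpha>) = multiplier (\<lambda>n. real n powr - \<alpha>)"
proof
  fix f
  show "composition_operator (\<lambda>s. s + of_real \<alpha>) f = multiplier (\<lambda>n. real n powr - \<alpha>) f"
    unfolding composition_operator_def
  proof (rule the_equality)
    fix g
    assume "\<forall>s\<in>half_plane (1/2). h2_eval g s = h2_eval f (s + of_real \<alpha>)"
    then show "g = multiplier (\<lambda>n. real n powr - \<alpha>) f"
      by (intro h2_eval_inject) (auto simp: h2_eval_translation half_plane_def)
  qed (simp add: h2_eval_translation)
qed

lemma translation_gordon_hedenmalm: "(\<lambda>s. s + of_real \<alpha>) \<in> gordon_hedenmalm"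
proof -
  \<comment> \<open>The series part of the symbol is the constant \<open>\<alpha>\<close>, carried
    by the term at \<open>n = 1\<close>.\<close>
  define c :: "nat \<Rightarrow> complex" where "c n = (if n = 1 then of_real \<alpha> else 0)" for n
  have series: "dirichlet_series c s = of_real \<alpha>" for s
  proof -
    have "(\<lambda>n. c (Suc n) * of_nat (Suc n) powr (- s)) = (\<lambda>n. if n = 0 then of_real \<alpha> else 0)"
      by (auto simp: c_def)
    then show ?thesis
      using sums_If_finite_set[of "{0::nat}" "\<lambda>_. complex_of_real \<alpha>"]
      by (simp add: dirichlet_series_def sums_iff)
  qed
  have "(\<Sum>n=1..N. c n * of_nat n powr (- s)) = of_real \<alpha>" if "N \<ge> 1" for N s
  proof -
    have "(\<Sum>n=1..N. c n * of_nat n powr (- s)) = (\<Sum>n\<in>{1..N}. if n = 1 then of_real \<alpha> else 0)"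
      by (intro sum.cong) (auto simp: c_def)
    with that show ?thesis by simp
  qed
  \<comment> \<open>From \<open>N = 1\<close> on, the partial sums equal the limit, so convergence
    is uniform on any set.\<close>
  then have "uniform_limit X (\<lambda>N s. \<Sum>n=1..N. c n * of_nat n powr (- s))
      (dirichlet_series c) sequentially" for X
    unfolding uniform_limit_iff
    by (auto simp: series intro!: eventually_mono[OF eventually_ge_at_top[of 1]])
  then show ?thesis
    using \<alpha> unfolding gordon_hedenmalm_def
    by (auto simp: half_plane_def series intro!: exI[of _ "1::nat"] exI[of _ c])
qed

lemma translation_dirichlet_polynomial: "dirichlet_polynomial (\<lambda>s. s + of_real \<alpha>)"
  unfolding dirichlet_polynomial_def
  \<comment> \<open>With \<open>N = 0\<close> the sum from 2 is empty, and the constant term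
    \<open>c 1\<close> is \<open>\<alpha>\<close>.\<close>
  by (intro exI[of _ "1::nat"] exI[of _ "\<lambda>_. of_real \<alpha>"] exI[of _ "0::nat"]) simp

lemma translation_schatten_class_iff:
  "composition_operator (\<lambda>s. s + of_real \<alpha>) \<in> schatten_class r \<longleftrightarrow> \<alpha> * r > 1"
proof -
  let ?w = "\<lambda>n. real n powr - \<alpha>"
  have "?w \<longlonglongrightarrow> 0"
    using \<alpha> by (intro tendsto_neg_powr filterlim_real_sequentially) simp
  then have "compact_operator (multiplier ?w)"
    by (rule compact_operator_multiplier[OF translation_weight_le_1])
  moreover have "approximation_number (Suc n) (multiplier ?w) = ?w (Suc n)" for n
    using \<alpha> by (intro approximation_number_multiplier powr_mono2') auto
  ultimately have "composition_operator (\<lambda>s. s + of_real \<alpha>) \<in> schatten_class r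
      \<longleftrightarrow> summable (\<lambda>n. real (Suc n) powr - (\<alpha> * r))"
    by (simp add: schatten_class_def composition_operator_translation powr_powr del: of_nat_Suc)
  also have "\<dots> \<longleftrightarrow> \<alpha> * r > 1"
    \<comment> \<open>Up to an index shift this is the sum of
      \<open>n powr - (\<alpha> * r)\<close>, which converges exactly for exponents
      \<open>\<alpha> * r\<close> above 1.\<close>
    using summable_Suc_iff[of "\<lambda>n. real n powr - (\<alpha> * r)"]
      summable_real_powr_iff[of "- (\<alpha> * r)"] by simp
  finally show ?thesis .
qed

end

theorem corollary4:
  fixes p q :: real
  assumes "0 < p" and "p < q"
  shows "\<exists>\<phi>\<in>gordon_hedenmalm. dirichlet_polynomial \<phi> \<and>
           composition_operator \<phi> \<in> schatten_class q - schatten_class p"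
proof (intro bexI conjI DiffI)
  \<comment> \<open>The shift \<open>1 / p\<close> makes \<open>p\<close> the critical exponent:
    there the sum is the harmonic series, whereas \<open>q / p > 1\<close>.\<close>
  let ?\<phi> = "\<lambda>s. s + of_real (1 / p)"
  have \<alpha>: "1 / p > 0" using assms by simp
  show "?\<phi> \<in> gordon_hedenmalm" "dirichlet_polynomial ?\<phi>"
    by (rule translation_gordon_hedenmalm[OF \<alpha>] translation_dirichlet_polynomial[OF \<alpha>])+
  show "composition_operator ?\<phi> \<in> schatten_class q" "composition_operator ?\<phi> \<notin> schatten_class p"
    using assms unfolding translation_schatten_class_iff[OF \<alpha>] by (auto simp: field_simps)
qed

end
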